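(* Consider the system $H(\mathfrak{q})[x]+L(\mathfrak{q})[z]+F(\mathfrak{q})[f_a+E(z)f_m]=0$ together with the following fault estimation filter. The fault detection block produces the residual $r=a^{-1}(\mathfrak{q})N(\mathfrak{q})L(\mathfrak{q})[z]$, where $N(\mathfrak{q})$ is characterized by the linear program described in the context and the denominator $a(\mathfrak{q})$ has distinct and real-valued poles. The pre-filter is the identity, i.e. $e=E(z)$. The fault isolation block is the regression operator with horizon $n$, so that $\widehat f=\Phi_n[e,r]$. Suppose the fault signals are constant, $f=(\bar f_a,\bar f_m)$, starting from the time $k_0$. Then, for any time instant $k\ge k_0+n$, we have $$\big\|\widehat f-f\big\|_2\le\frac{\mathcal{C}_n(\mathbf{e}_n)}{\sqrt n\,V_n[e]}\Big(\mathcal{C}_1\big(|\bar f_a|+|\bar f_m|\,\big|\mu_{k-k_0}[e]\big|\big)|p|^{k-n-k_0}+\mathcal{C}_2\sqrt{k-k_0}\,|\bar f_m|\,V_{k-k_0}[e]\Big),$$ where all signals are evaluated at time $k$ and $p\in\mathbb{R}$ is the dominant pole of $a(\mathfrak{q})$ (the one closest to the unit circle).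
   Context: Time and signals. Signals are functions of discrete time; $\mathfrak{q}$ is the forward shift $\mathfrak{q}[x(k)]=x(k+1)$. For a scalar signal $x$ and $m\ge1$: $\mathbf{x}_m(k)=[x(k),x(k-1),\dots,x(k-m+1)]^{\intercal}$, $\mu_m[x](k)=\frac1m\sum_{i=0}^{m-1}x(k-i)$, and $V_m[x](k)\ge0$ with $V_m^2[x](k)=\frac1m\sum_{i=0}^{m-1}x^2(k-i)-(\mu_m[x](k))^2$. "Constant starting from time $k_0$" means $f_a(t)=f_m(t)=0$ for $t<k_0$ and $f_a(t)=\bar f_a$, $f_m(t)=\bar f_m$ for $t\ge k_0$, with real constants $\bar f_a,\bar f_m$. The bound presupposes $V_n[e](k)\ne0$. System. $H,L,F$ are polynomial matrices in $\mathfrak{q}$ with the same number of rows, $F$ being a column vector; $x$ (unknown) and $z$ (known) are vector signals, $f_a,f_m$ are scalar signals (additive and multiplicative fault), $f=[f_a,f_m]^{\intercal}$, and $E$ is a known static scalar-valued map applied pointwise in time to $z$. Standing detectability assumption: $\mathrm{Rank}[H(\mathfrak{q}),F(\mathfrak{q})]>\mathrm{Rank}\,H(\mathfrak{q})$. Fault detection block. $N(\mathfrak{q})=\sum_{i=0}^{d_N}N_i\mathfrak{q}^i$ is a polynomial row vector whose coefficients solve the linear program (linear feasibility problem) expressing $N(\mathfrak{q})H(\mathfrak{q})=0$ (all coefficients vanish) and $N(1)F(1)=-a(1)$. The denominator is $a(\mathfrak{q})=\prod_{i=1}^{d}(\mathfrak{q}-p_i)$ with distinct real $p_i$, $|p_i|<1$,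 of degree large enough to make the filter proper. With $\mathcal{T}=-N(\mathfrak{q})F(\mathfrak{q})/a(\mathfrak{q})$ (so $\mathcal{T}(1)=1$), the mapping from the faults to the residual is $r=\mathcal{T}[f_a+E(z)f_m]$. Fault isolation block. $\Phi_n[e,r](k)=\phi_n[e](k)^\dagger\,\mathbf{r}_n(k)\in\mathbb{R}^2$ with $\phi_n[e](k)=[\mathbf{1}_n,\mathbf{e}_n(k)]\in\mathbb{R}^{n\times2}$, $\mathbf{1}_n$ the all-ones vector, $A^\dagger=(A^{\intercal}A)^{-1}A^{\intercal}$. Constants. $\mathcal{C}_n(\mathbf{e}_n)=\sqrt{V_n^2[e]+\mu_n^2[e]+1}$. Write the zero-steady-state-gain transfer function $\mathcal{T}-1$ as $b(\mathfrak{q})/a(\mathfrak{q})$ with $b(\mathfrak{q})=\sum_{i=0}^{d}b_i\mathfrak{q}^i$, and let $r_i=b(p_i)/\prod_{j\ne i}(p_i-p_j)$. Then $\mathcal{C}_1=\frac{\sqrt{n\,d\sum_{i=1}^{d}r_i^2}}{1-|p|}$ and $\mathcal{C}_2=|b_d|+\sum_{i=1}^{d}\frac{|r_i|}{1-|p_i|}$.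
   Formalization: The faults are taken to be zero up to and including time k_0 and constant from time k_0+1 on (not from k_0); with onset at k_0 the printed bound fails, since the value of e at k_0 enters the residual but not the right-hand side. *)

theory Defs
  imports
    "HOL-Analysis.Analysis"
    "HOL-Computational_Algebra.Computational_Algebra"
begin

section \<open>Polynomials in the forward shift acting on signals\<close>

text \<open>Time is the set of all integers, so "no fault before the onset" leaves the past unrestricted.\<close>

type_synonym signal = "int \<Rightarrow> real"

definition shift_op :: "real poly \<Rightarrow> signal \<Rightarrow> signal" where
  "shift_op P s k = (\<Sum>i\<le>degree P. coeff P i * s (k + int i))"

definition row_op :: "(real poly) ^ 'c \<Rightarrow> (int \<Rightarrow> real ^ 'c) \<Rightarrow> signal" where
  "row_op M s k = (\<Sum>j\<in>UNIV. shift_op (M $ j) (\<lambda>t. s t $ j) k)"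

definition mat_op :: "(real poly) ^ 'c ^ 'r \<Rightarrow> (int \<Rightarrow> real ^ 'c) \<Rightarrow> int \<Rightarrow> real ^ 'r" where
  "mat_op M s k = (\<chi> i. row_op (M $ i) s k)"

definition col_op :: "(real poly) ^ 'r \<Rightarrow> signal \<Rightarrow> int \<Rightarrow> real ^ 'r" where
  "col_op M s k = (\<chi> i. shift_op (M $ i) s k)"

text \<open>
  The causal filter 1/a(q). With m = degree a and w = 1/q one has
  1/a(q) = w^m / a'(w), where a' is the reflected polynomial of a; the coefficients of the
  power series 1/a' are therefore the impulse response, delayed by m samples. This is the
  zero-state response: for an input that vanishes before some time, the sum has finitely many
  nonzero terms and is the only solution y of a(q)[y] = s that vanishes far enough in the past.
\<close>

definition inv_shift_op :: "real poly \<Rightarrow> signal \<Rightarrow> signal" where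
  "inv_shift_op a s k =
     (\<Sum>i. fps_nth (inverse (fps_of_poly (reflect_poly a))) i * s (k - int (degree a) - int i))"


section \<open>Rank of polynomial matrices\<close>

text \<open>Rank over the field of rational functions.\<close>

definition poly_rank :: "(real poly) ^ 'c ^ 'r \<Rightarrow> nat" where
  "poly_rank M = rank (\<chi> i j. to_fract (M $ i $ j))"

definition append_col :: "'a ^ 'c ^ 'r \<Rightarrow> 'a ^ 'r \<Rightarrow> 'a ^ ('c + unit) ^ 'r" where
  "append_col H F = (\<chi> i j. case j of Inl c \<Rightarrow> H $ i $ c | Inr _ \<Rightarrow> F $ i)"


section \<open>Fault detection block\<close>

definition row_times_col :: "(real poly) ^ 'r \<Rightarrow> (real poly) ^ 'r \<Rightarrow> real poly" where
  "row_times_col N F = (\<Sum>i\<in>UNIV. N $ i * F $ i)"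

definition denominator :: "nat \<Rightarrow> (nat \<Rightarrow> real) \<Rightarrow> real poly" where
  "denominator d pole = (\<Prod>i\<in>{1..d}. [:- pole i, 1:])"

definition detection_lp ::
    "nat \<Rightarrow> (real poly) ^ 'x ^ 'r \<Rightarrow> (real poly) ^ 'r \<Rightarrow> real poly \<Rightarrow> (real poly) ^ 'r \<Rightarrow> bool" where
  "detection_lp dN H F a N \<longleftrightarrow>
     (\<forall>i. degree (N $ i) \<le> dN) \<and>
     N v* H = 0 \<and>
     poly (row_times_col N F) 1 = - poly a 1"

text \<open>
  Properness of the two transfer functions N L / a (known signals to residual) and
  - N F / a (faults to residual).
\<close>

definition proper_filter ::
    "(real poly) ^ 'z ^ 'r \<Rightarrow> (real poly) ^ 'r \<Rightarrow> real poly \<Rightarrow> (real poly) ^ 'r \<Rightarrow> bool" where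
  "proper_filter L F a N \<longleftrightarrow>
     (\<forall>j. degree ((N v* L) $ j) \<le> degree a) \<and> degree (row_times_col N F) \<le> degree a"

definition residual ::
    "(real poly) ^ 'z ^ 'r \<Rightarrow> real poly \<Rightarrow> (real poly) ^ 'r \<Rightarrow> (int \<Rightarrow> real ^ 'z) \<Rightarrow> signal" where
  "residual L a N z = inv_shift_op a (row_op N (mat_op L z))"


section \<open>Fault isolation block\<close>

text \<open>
  An n-by-2 matrix A is represented by its rows A 0, ..., A (n - 1). The value
  pinv_mult n A y is (A^T A)^(-1) A^T y.
\<close>

definition gram :: "nat \<Rightarrow> (nat \<Rightarrow> real ^ 2) \<Rightarrow> real ^ 2 ^ 2" where
  "gram n A = (\<chi> j l. \<Sum>i<n. A i $ j * A i $ l)"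

definition pinv_mult :: "nat \<Rightarrow> (nat \<Rightarrow> real ^ 2) \<Rightarrow> (nat \<Rightarrow> real) \<Rightarrow> real ^ 2" where
  "pinv_mult n A y = matrix_inv (gram n A) *v (\<Sum>i<n. y i *\<^sub>R A i)"

definition regressor :: "signal \<Rightarrow> int \<Rightarrow> nat \<Rightarrow> real ^ 2" where
  "regressor e k i = vector [1, e (k - int i)]"

definition regression :: "nat \<Rightarrow> signal \<Rightarrow> signal \<Rightarrow> int \<Rightarrow> real ^ 2" where
  "regression n e r k = pinv_mult n (regressor e k) (\<lambda>i. r (k - int i))"


section \<open>Constants of the error bound\<close>

definition avg :: "nat \<Rightarrow> signal \<Rightarrow> signal" where
  "avg m s k = (\<Sum>i<m. s (k - int i)) / real m"

definition stdev :: "nat \<Rightarrow> signal \<Rightarrow> signal" where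
  "stdev m s k = sqrt ((\<Sum>i<m. (s (k - int i))\<^sup>2) / real m - (avg m s k)\<^sup>2)"

definition C_reg :: "nat \<Rightarrow> signal \<Rightarrow> signal" where
  "C_reg n e k = sqrt ((stdev n e k)\<^sup>2 + (avg n e k)\<^sup>2 + 1)"

text \<open>The numerator of (- N F / a) - 1 over the denominator a.\<close>

definition numerator :: "(real poly) ^ 'r \<Rightarrow> (real poly) ^ 'r \<Rightarrow> real poly \<Rightarrow> real poly" where
  "numerator N F a = - row_times_col N F - a"

definition pole_residue :: "nat \<Rightarrow> (nat \<Rightarrow> real) \<Rightarrow> real poly \<Rightarrow> nat \<Rightarrow> real" where
  "pole_residue d pole b i = poly b (pole i) / (\<Prod>j\<in>{1..d} - {i}. pole i - pole j)"

definition dominant_pole :: "nat \<Rightarrow> (nat \<Rightarrow> real) \<Rightarrow> real \<Rightarrow> bool" where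
  "dominant_pole d pole p \<longleftrightarrow> p \<in> pole ` {1..d} \<and> (\<forall>i\<in>{1..d}. \<bar>pole i\<bar> \<le> \<bar>p\<bar>)"

definition C_one :: "nat \<Rightarrow> nat \<Rightarrow> (nat \<Rightarrow> real) \<Rightarrow> real poly \<Rightarrow> real \<Rightarrow> real" where
  "C_one n d pole b p =
     sqrt (real n * real d * (\<Sum>i\<in>{1..d}. (pole_residue d pole b i)\<^sup>2)) / (1 - \<bar>p\<bar>)"

definition C_two :: "nat \<Rightarrow> (nat \<Rightarrow> real) \<Rightarrow> real poly \<Rightarrow> real" where
  "C_two d pole b =
     \<bar>coeff b d\<bar> + (\<Sum>i\<in>{1..d}. \<bar>pole_residue d pole b i\<bar> / (1 - \<bar>pole i\<bar>))"


section \<open>Constant faults\<close>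

text \<open>
  Pitfall: avg m s k and stdev m s k look at the m samples at times k - m + 1, ..., k. With
  m = k - k0 they do not see the sample at time k0. An error bound that depends on e only through
  these windows (and the regression window) can therefore hold only if the first faulty sample is
  the one at time k0 + 1, i.e. for constant_from (k0 + 1): a faulty sample at time k0 would enter
  the residual with the factor e k0, which such a bound does not control.
\<close>

definition constant_from :: "int \<Rightarrow> signal \<Rightarrow> real \<Rightarrow> bool" where
  "constant_from t0 f c \<longleftrightarrow> (\<forall>t<t0. f t = 0) \<and> (\<forall>t\<ge>t0. f t = c)"

end

theory Submission
  imports Defs
begin

text \<open>
  Multiplying the system by N eliminates x, so the residual is (1 + b/a)[g] with
  g = f_a + e f_m. On the regression window g is exactly the regressor applied to the faults, hence
  the estimation error is the pseudo-inverse applied to (b/a)[g]. The norm of the pseudo-inverse is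
  controlled by the trace and the determinant of the Gram matrix. After the onset, g splits into a
  step of height fbar_a + fbar_m mu, where mu is the mean of e since the onset, and fbar_m times
  the deviation of e from mu. By partial fractions and b(1) = 0 the response of b/a to the step
  consists of decaying geometric terms only; the response to the deviation is bounded in the l2
  norm by the l1 norm of the impulse response of b/a, which is at most C_two.
\<close>

section \<open>Algebra of shift operators\<close>

text \<open>Padding with zero coefficients frees the sum from the exact degree, which can drop when
  polynomials are added.\<close>

lemma shift_op_degree_le:
  assumes "degree P \<le> M"
  shows "shift_op P s k = (\<Sum>i\<le>M. coeff P i * s (k + int i))"
  unfolding shift_op_def
  by (rule sum.mono_neutral_left) (use assms in \<open>auto simp: coeff_eq_0\<close>)

lemma shift_op_0 [simp]: "shift_op 0 s k = 0"
  by (simp add: shift_op_def)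

text \<open>Horner form of the operator; it drives the inductions over polynomials below.\<close>

lemma shift_op_pCons: "shift_op (pCons c P) s k = c * s k + shift_op P s (k + 1)"
proof -
  have "shift_op (pCons c P) s k =
      (\<Sum>i\<le>Suc (degree P). coeff (pCons c P) i * s (k + int i))"
    by (rule shift_op_degree_le) (simp add: degree_pCons_le)
  also have "\<dots> = c * s k + (\<Sum>i\<le>degree P. coeff P i * s (k + 1 + int i))"
    by (subst sum.atMost_Suc_shift) (simp add: add.assoc)
  finally show ?thesis
    by (simp add: shift_op_def)
qed

lemma shift_op_add_poly: "shift_op (P + Q) s k = shift_op P s k + shift_op Q s k"
proof -
  define M where "M = max (degree P) (degree Q)"
  have "degree P \<le> M" "degree Q \<le> M" "degree (P + Q) \<le> M"
    by (auto simp: M_def degree_add_le_max)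
  then show ?thesis
    by (simp add: shift_op_degree_le sum.distrib distrib_right)
qed

lemma shift_op_sum_poly: "shift_op (\<Sum>i\<in>I. P i) s k = (\<Sum>i\<in>I. shift_op (P i) s k)"
  by (induction I rule: infinite_finite_induct) (simp_all add: shift_op_add_poly)

lemma shift_op_smult_poly: "shift_op (smult c P) s k = c * shift_op P s k"
  by (induction P arbitrary: k) (simp_all add: shift_op_pCons distrib_left)

lemma shift_op_add: "shift_op P (\<lambda>t. s t + u t) k = shift_op P s k + shift_op P u k"
  by (simp add: shift_op_def sum.distrib distrib_left)

lemma shift_op_scale: "shift_op P (\<lambda>t. c * s t) k = c * shift_op P s k"
  by (simp add: shift_op_def sum_distrib_left mult_ac)

lemma shift_op_zero: "shift_op P (\<lambda>t. 0) k = 0"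
  by (simp add: shift_op_def)

lemma shift_op_sum: "shift_op P (\<lambda>t. \<Sum>i\<in>I. s i t) k = (\<Sum>i\<in>I. shift_op P (s i) k)"
  by (induction I rule: infinite_finite_induct) (simp_all add: shift_op_add shift_op_zero)

text \<open>Polynomials act as a commutative ring of operators, so any single factor of the
  denominator can be applied to a signal first.\<close>

lemma shift_op_mult: "shift_op (P * Q) s k = shift_op P (shift_op Q s) k"
  by (induction P arbitrary: k)
    (simp_all add: shift_op_pCons shift_op_add_poly shift_op_smult_poly)

lemma row_op_add: "row_op N (\<lambda>t. s t + u t) k = row_op N s k + row_op N u k"
  by (simp add: row_op_def shift_op_add sum.distrib)

lemma row_op_mat_op: "row_op N (mat_op M s) k = row_op (N v* M) s k"
proof -
  have "row_op N (mat_op M s) k =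
      (\<Sum>i\<in>UNIV. \<Sum>j\<in>UNIV. shift_op (N $ i * M $ i $ j) (\<lambda>t. s t $ j) k)"
    by (simp add: row_op_def mat_op_def shift_op_sum shift_op_mult)
  also have "\<dots> = row_op (N v* M) s k"
    by (subst sum.swap) (simp add: row_op_def vector_matrix_mult_def shift_op_sum_poly mult.commute)
  finally show ?thesis .
qed

lemma row_op_col_op: "row_op N (col_op F g) k = shift_op (row_times_col N F) g k"
  by (simp add: row_op_def col_op_def row_times_col_def shift_op_sum_poly shift_op_mult)

text \<open>Applying \<open>N\<close> to the system annihilates the unknown \<open>x\<close>,
  because \<open>N v* H = 0\<close>; what is left expresses the filter input through the fault
  signal alone.\<close>

lemma row_op_residual_input:
  assumes "\<forall>t. mat_op H x t + mat_op L z t + col_op F g t = 0" and "N v* H = 0"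
  shows "row_op N (mat_op L z) k = shift_op (- row_times_col N F) g k"
proof -
  have "row_op N (\<lambda>t. mat_op H x t + mat_op L z t + col_op F g t) k = 0"
    using assms(1) by (simp add: row_op_def shift_op_zero)
  moreover have "row_op N (mat_op H x) k = 0"
    unfolding row_op_mat_op assms(2) by (simp add: row_op_def)
  moreover have "shift_op (- row_times_col N F) g k = - shift_op (row_times_col N F) g k"
    using shift_op_smult_poly[of "-1"] by simp
  ultimately show ?thesis
    by (simp add: row_op_add row_op_col_op)
qed

section \<open>The causal inverse and partial fractions\<close>

text \<open>Read from the newest sample backwards, a forward-shift polynomial is a convolution with
  its reflected polynomial. As \<open>y\<close> starts at \<open>t0\<close>, this convolution is a
  Cauchy product of power series.\<close>

lemma shift_op_eq_fps_nth:
  assumes "\<And>t. t < t0 \<Longrightarrow> y t = 0"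
  shows "shift_op a y (t0 + int m - int (degree a)) =
    fps_nth (fps_of_poly (reflect_poly a) * Abs_fps (\<lambda>s. y (t0 + int s))) m"
proof -
  define d where "d = degree a"
  have "shift_op a y (t0 + int m - int d) =
      (\<Sum>i\<le>d. coeff a (d - i) * y (t0 + int m - int i))"
    unfolding shift_op_def d_def[symmetric]
    by (subst sum.nat_diff_reindex[symmetric, where n = "Suc d", unfolded lessThan_Suc_atMost])
      (auto intro!: sum.cong simp: of_nat_diff add_diff_eq)
  also have "\<dots> = (\<Sum>i\<le>d. coeff (reflect_poly a) i * y (t0 + int m - int i))"
    by (rule sum.cong) (auto simp: coeff_reflect_poly d_def)
  \<comment> \<open>The range is first enlarged, where the reflected coefficients beyond
    \<open>d\<close> vanish, and then cut to \<open>m\<close>, where the samples before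
    \<open>t0\<close> vanish.\<close>
  also have "\<dots> = (\<Sum>i\<le>max d m. coeff (reflect_poly a) i * y (t0 + int m - int i))"
    by (rule sum.mono_neutral_left) (auto simp: coeff_reflect_poly d_def)
  also have "\<dots> = (\<Sum>i\<le>m. coeff (reflect_poly a) i * y (t0 + int m - int i))"
    by (rule sum.mono_neutral_right) (auto simp: assms)
  finally show ?thesis
    by (auto simp: fps_mult_nth d_def atLeast0AtMost of_nat_diff add_diff_eq intro!: sum.cong)
qed

text \<open>In power series the claim is \<open>inverse A * (A * Y) = Y\<close>; the constant
  coefficient of \<open>A\<close> is the leading coefficient of \<open>a\<close>, hence
  invertible.\<close>

lemma inv_shift_op_shift_op:
  assumes y: "\<And>t. t < t0 \<Longrightarrow> y t = 0" and "a \<noteq> 0" and "t0 \<le> k"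
  shows "inv_shift_op a (shift_op a y) k = y k"
proof -
  define A where "A = fps_of_poly (reflect_poly a)"
  define Y where "Y = Abs_fps (\<lambda>s. y (t0 + int s))"
  define K where "K = nat (k - t0)"
  have kK: "k = t0 + int K"
    using assms by (simp add: K_def)
  \<comment> \<open>For \<open>i > K\<close> even the newest sample involved, at time
    \<open>k - i\<close>, precedes \<open>t0\<close>, so the series is a finite sum.\<close>
  have "inv_shift_op a (shift_op a y) k =
      (\<Sum>i\<le>K. fps_nth (inverse A) i * shift_op a y (k - int (degree a) - int i))"
    unfolding inv_shift_op_def A_def
  proof (rule suminf_finite)
    fix i assume "i \<notin> {..K}"
    then have "shift_op a y (k - int (degree a) - int i) = 0"
      by (auto simp: shift_op_def kK intro!: sum.neutral y)
    then show "fps_nth (inverse (fps_of_poly (reflect_poly a))) i *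
        shift_op a y (k - int (degree a) - int i) = 0" by simp
  qed simp
  also have "\<dots> = (\<Sum>i\<le>K. fps_nth (inverse A) i * fps_nth (A * Y) (K - i))"
  proof (rule sum.cong)
    fix i assume "i \<in> {..K}"
    then have "k - int (degree a) - int i = t0 + int (K - i) - int (degree a)"
      by (simp add: kK of_nat_diff)
    then show "fps_nth (inverse A) i * shift_op a y (k - int (degree a) - int i) =
        fps_nth (inverse A) i * fps_nth (A * Y) (K - i)"
      using shift_op_eq_fps_nth[OF y, where a = a] by (simp only: A_def Y_def)
  qed simp
  also have "\<dots> = fps_nth (inverse A * (A * Y)) K"
    by (simp only: fps_mult_nth[of "inverse A"] atLeast0AtMost)
  also have "inverse A * (A * Y) = Y"
    using \<open>a \<noteq> 0\<close> by (simp add: A_def inverse_mult_eq_1 flip: mult.assoc)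
  finally show ?thesis
    by (simp add: Y_def kK)
qed

section \<open>Denominator and partial fractions\<close>

lemma degree_prod_linear: "degree (\<Prod>i\<in>I. [:- q i, 1:] :: real poly) = card I"
  by (cases "finite I") (simp_all add: degree_prod_eq_sum_degree)

lemma lead_coeff_prod_linear: "lead_coeff (\<Prod>i\<in>I. [:- q i, 1:] :: real poly) = 1"
  by (simp add: lead_coeff_prod)

lemma degree_denominator: "degree (denominator d pole) = d"
  by (simp add: denominator_def degree_prod_linear)

lemma denominator_nonzero: "denominator d pole \<noteq> 0"
  by (simp add: denominator_def)

lemma poly_denominator_1_nonzero:
  assumes "\<forall>i\<in>{1..d}. \<bar>pole i\<bar> < 1"
  shows "poly (denominator d pole) 1 \<noteq> 0"
proof -
  have "(\<Prod>i\<in>{1..d}. 1 - pole i) \<noteq> 0"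
    using assms by (subst prod_zero_iff) force+
  then show ?thesis
    by (simp add: denominator_def poly_prod)
qed

lemma poly_denominator_pole: "i \<in> {1..d} \<Longrightarrow> poly (denominator d pole) (pole i) = 0"
  by (auto simp: denominator_def poly_prod)

text \<open>The residue normalises the cofactor of a pole to a Lagrange basis polynomial times the
  value of \<open>b\<close> there.\<close>

lemma pole_residue_times_poly:
  assumes "inj_on pole {1..d}" and "i \<in> {1..d}"
  shows "pole_residue d pole b l * poly (\<Prod>j\<in>{1..d} - {l}. [:- pole j, 1:]) (pole i) =
    (if l = i then poly b (pole i) else 0)"
proof (cases "l = i")
  case True
  have "(\<Prod>j\<in>{1..d} - {i}. pole i - pole j) \<noteq> 0"
    using assms by (subst prod_zero_iff) (auto dest: inj_onD)
  with True show ?thesis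
    by (simp add: poly_prod pole_residue_def)
next
  case False
  then have "(\<Prod>j\<in>{1..d} - {l}. pole i - pole j) = 0"
    using assms(2) by auto
  with False show ?thesis
    by (simp add: poly_prod)
qed

text \<open>The expansion of b/a, multiplied through by a. Both sides have degree at most
  \<open>d\<close>, share the coefficient of degree \<open>d\<close> and agree at the
  \<open>d\<close> distinct poles.\<close>

lemma partial_fractions:
  assumes "inj_on pole {1..d}" and "degree b \<le> d" and "d \<ge> 1"
  shows "b = smult (coeff b d) (denominator d pole) +
    (\<Sum>i\<in>{1..d}. smult (pole_residue d pole b i) (\<Prod>j\<in>{1..d} - {i}. [:- pole j, 1:]))"
    (is "_ = ?A + ?S")
proof (rule poly_eqI_degree_lead_coeff[where A = "pole ` {1..d}" and n = d])
  have S: "degree ?S < d"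
  proof -
    have "degree ?S \<le> d - 1"
    proof (rule degree_sum_le)
      fix i assume "i \<in> {1..d}"
      then show "degree (smult (pole_residue d pole b i) (\<Prod>j\<in>{1..d} - {i}. [:- pole j, 1:])) \<le> d - 1"
        by (intro order.trans[OF degree_smult_le]) (simp only: degree_prod_linear, simp)
    qed simp
    then show ?thesis using \<open>d \<ge> 1\<close> by simp
  qed
  have "degree ?A \<le> d"
    by (simp add: degree_denominator)
  then show "degree (?A + ?S) \<le> d"
    by (rule degree_add_le) (use S in linarith)
  have "coeff (denominator d pole) d = 1"
    using lead_coeff_prod_linear[of pole "{1..d}"] degree_denominator[of d pole]
    by (simp add: denominator_def)
  moreover have "coeff ?S d = 0"
    using S by (rule coeff_eq_0)
  ultimately show "coeff b d = coeff (?A + ?S) d"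
    by (simp only: coeff_add coeff_smult mult_1_right add_0_right)
  show "d \<le> card (pole ` {1..d})"
    using assms by (simp add: card_image)
  show "poly b x = poly (?A + ?S) x" if "x \<in> pole ` {1..d}" for x
    using that assms(1)
    by (auto simp only: poly_add poly_smult poly_sum poly_denominator_pole
        pole_residue_times_poly sum.delta finite_atLeastAtMost if_True mult_zero_right add_0_left)
qed (rule \<open>degree b \<le> d\<close>)

text \<open>Needed at \<open>x = 1\<close>, where it expresses the steady-state gain of b/a through
  the residues.\<close>

lemma poly_over_denominator:
  assumes "inj_on pole {1..d}" and "degree b \<le> d" and "d \<ge> 1"
    and "poly (denominator d pole) x \<noteq> 0"
  shows "poly b x / poly (denominator d pole) x =
    coeff b d + (\<Sum>i\<in>{1..d}. pole_residue d pole b i / (x - pole i))"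
proof -
  let ?a = "poly (denominator d pole) x"
  have *: "(\<Prod>j\<in>{1..d} - {i}. x - pole j) / ?a = 1 / (x - pole i)" if "i \<in> {1..d}" for i
  proof -
    have "?a = (x - pole i) * (\<Prod>j\<in>{1..d} - {i}. x - pole j)"
      using that by (subst prod.remove[symmetric]) (simp_all add: denominator_def poly_prod)
    then show ?thesis using assms(4) by auto
  qed
  have "poly b x = coeff b d * ?a +
      (\<Sum>i\<in>{1..d}. pole_residue d pole b i * (\<Prod>j\<in>{1..d} - {i}. x - pole j))"
    by (subst partial_fractions[OF assms(1-3)]) (simp add: poly_sum poly_prod)
  then have "poly b x / ?a = coeff b d +
      (\<Sum>i\<in>{1..d}. pole_residue d pole b i * ((\<Prod>j\<in>{1..d} - {i}. x - pole j) / ?a))"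
    using assms(4) by (simp add: add_divide_distrib sum_divide_distrib)
  also have "\<dots> = coeff b d + (\<Sum>i\<in>{1..d}. pole_residue d pole b i / (x - pole i))"
    using * by (intro arg_cong2[where f = "(+)"] sum.cong) auto
  finally show ?thesis .
qed

text \<open>Zero-state response of 1/(q - pole), written as a finite sum: the cut at
  \<open>nat (t - t0)\<close> keeps exactly the samples from \<open>t0\<close> on, and the sum is
  empty for \<open>t \<le> t0\<close>.\<close>

definition first_order :: "real \<Rightarrow> int \<Rightarrow> signal \<Rightarrow> signal" where
  "first_order q t0 s t = (\<Sum>j<nat (t - t0). q ^ j * s (t - 1 - int j))"

lemma shift_op_first_order:
  assumes "\<And>t. t < t0 \<Longrightarrow> s t = 0"
  shows "shift_op [:- q, 1:] (first_order q t0 s) = s"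
proof
  fix t
  have "first_order q t0 s (t + 1) = q * first_order q t0 s t + s t"
  proof (cases "t0 \<le> t")
    case True
    then have "nat (t + 1 - t0) = Suc (nat (t - t0))" by simp
    then have "first_order q t0 s (t + 1) =
        (\<Sum>j<Suc (nat (t - t0)). q ^ j * s (t - int j))"
      by (simp add: first_order_def)
    also have "\<dots> = q * first_order q t0 s t + s t"
      by (subst sum.lessThan_Suc_shift)
        (simp add: first_order_def sum_distrib_left algebra_simps)
    finally show ?thesis .
  qed (use assms in \<open>auto simp: first_order_def\<close>)
  then show "shift_op [:- q, 1:] (first_order q t0 s) t = s t"
    by (simp add: shift_op_pCons)
qed

text \<open>The response of b/a in the time domain: a direct feedthrough plus one geometric mode per
  pole.\<close>

definition filter_pfd :: "nat \<Rightarrow> (nat \<Rightarrow> real) \<Rightarrow> real poly \<Rightarrow> int \<Rightarrow> signal \<Rightarrow> signal" where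
  "filter_pfd d pole b t0 s t =
    coeff b d * s t + (\<Sum>i\<in>{1..d}. pole_residue d pole b i * first_order (pole i) t0 s t)"

lemma shift_op_filter_pfd:
  assumes "inj_on pole {1..d}" and "degree b \<le> d" and "d \<ge> 1"
    and s: "\<And>t. t < t0 \<Longrightarrow> s t = 0"
  shows "shift_op (denominator d pole) (filter_pfd d pole b t0 s) k = shift_op b s k"
proof -
  \<comment> \<open>The factor of pole \<open>i\<close> cancels against the first-order response and
    leaves the cofactor acting on \<open>s\<close>.\<close>
  have *: "shift_op (denominator d pole) (first_order (pole i) t0 s) k =
      shift_op (\<Prod>j\<in>{1..d} - {i}. [:- pole j, 1:]) s k" if "i \<in> {1..d}" for i
  proof -
    have "denominator d pole = (\<Prod>j\<in>{1..d} - {i}. [:- pole j, 1:]) * [:- pole i, 1:]"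
      using that by (simp add: denominator_def prod.remove mult.commute)
    then show ?thesis
      by (simp only: shift_op_mult shift_op_first_order[OF s])
  qed
  have "shift_op (denominator d pole) (filter_pfd d pole b t0 s) k =
      shift_op (smult (coeff b d) (denominator d pole) +
        (\<Sum>i\<in>{1..d}. smult (pole_residue d pole b i) (\<Prod>j\<in>{1..d} - {i}. [:- pole j, 1:]))) s k"
    unfolding filter_pfd_def
    by (simp add: shift_op_add shift_op_sum shift_op_scale shift_op_add_poly shift_op_sum_poly
        shift_op_smult_poly *)
  then show ?thesis
    using partial_fractions[OF assms(1-3)] by simp
qed

text \<open>The signal \<open>s + w\<close> vanishes before \<open>t0\<close> and is mapped by a(q)
  to (a + b)(q)[s], so the causal inverse recovers it.\<close>

lemma inv_shift_op_eq_filter_pfd: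
  assumes "inj_on pole {1..d}" and "degree b \<le> d" and "d \<ge> 1"
    and s: "\<And>t. t < t0 \<Longrightarrow> s t = 0" and "t0 \<le> k"
  shows "inv_shift_op (denominator d pole) (shift_op (denominator d pole + b) s) k =
    s k + filter_pfd d pole b t0 s k"
proof -
  define a where "a = denominator d pole"
  define w where "w = filter_pfd d pole b t0 s"
  have w0: "w t = 0" if "t < t0" for t
    using s[OF that] that by (simp add: w_def filter_pfd_def first_order_def)
  have w: "shift_op a w t = shift_op b s t" for t
    unfolding w_def a_def by (rule shift_op_filter_pfd) (use assms in blast)+
  have "shift_op (a + b) s = shift_op a (\<lambda>t. s t + w t)"
    by (rule ext) (simp only: shift_op_add shift_op_add_poly w)
  moreover have "inv_shift_op a (shift_op a (\<lambda>t. s t + w t)) k = s k + w k"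
  proof (rule inv_shift_op_shift_op)
    show "s t + w t = 0" if "t < t0" for t
      by (simp only: w0[OF that] s[OF that])
    show "a \<noteq> 0"
      unfolding a_def by (rule denominator_nonzero)
  qed (rule \<open>t0 \<le> k\<close>)
  ultimately show ?thesis
    unfolding a_def w_def by (simp only:)
qed

section \<open>Norm bounds for the filter\<close>

lemma filter_pfd_add:
  "filter_pfd d pole b t0 (\<lambda>t. s t + u t) t = filter_pfd d pole b t0 s t + filter_pfd d pole b t0 u t"
  by (simp add: filter_pfd_def first_order_def sum.distrib distrib_left)

lemma filter_pfd_scale:
  "filter_pfd d pole b t0 (\<lambda>t. c * s t) t = c * filter_pfd d pole b t0 s t"
  by (simp add: filter_pfd_def first_order_def sum_distrib_left algebra_simps)

lemma first_order_step:
  assumes "t0 \<le> t" and "q \<noteq> 1"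
  shows "first_order q t0 (\<lambda>t. if t0 \<le> t then 1 else 0) t = (1 - q ^ nat (t - t0)) / (1 - q)"
proof -
  have "first_order q t0 (\<lambda>t. if t0 \<le> t then 1 else 0) t = (\<Sum>j<nat (t - t0). q ^ j)"
    unfolding first_order_def by (rule sum.cong) auto
  then show ?thesis
    using assms by (simp add: sum_gp_strict)
qed

text \<open>The steady-state part of the step response is b(1)/a(1) = 0. Only transients remain,
  each dominated by the slowest pole.\<close>

lemma filter_pfd_step_bound:
  assumes "inj_on pole {1..d}" and "degree b \<le> d" and "d \<ge> 1"
    and stable: "\<forall>i\<in>{1..d}. \<bar>pole i\<bar> < 1"
    and "dominant_pole d pole p" and "poly b 1 = 0" and t: "t0 + int l \<le> t"
  shows "\<bar>filter_pfd d pole b t0 (\<lambda>t. if t0 \<le> t then 1 else 0) t\<bar> \<le>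
    sqrt (real d * (\<Sum>i\<in>{1..d}. (pole_residue d pole b i)\<^sup>2)) / (1 - \<bar>p\<bar>) * \<bar>p\<bar> ^ l"
proof -
  define \<rho> where "\<rho> = pole_residue d pole b"
  define K where "K = nat (t - t0)"
  have p1: "\<bar>p\<bar> < 1" and dom: "\<bar>pole i\<bar> \<le> \<bar>p\<bar>" if "i \<in> {1..d}" for i
    using assms(5) stable that by (auto simp: dominant_pole_def)
  have "1 \<in> {1..d}" using \<open>d \<ge> 1\<close> by simp
  with p1 have p1: "\<bar>p\<bar> < 1" by blast
  have "coeff b d + (\<Sum>i\<in>{1..d}. \<rho> i / (1 - pole i)) = 0"
    using poly_over_denominator[OF assms(1-3) poly_denominator_1_nonzero[OF stable]] assms(6)
    by (simp add: \<rho>_def)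
  moreover have "filter_pfd d pole b t0 (\<lambda>t. if t0 \<le> t then 1 else 0) t =
      coeff b d + (\<Sum>i\<in>{1..d}. \<rho> i / (1 - pole i) - \<rho> i * pole i ^ K / (1 - pole i))"
  proof -
    have "t0 \<le> t" using t by simp
    have "(\<Sum>i\<in>{1..d}. \<rho> i * first_order (pole i) t0 (\<lambda>t. if t0 \<le> t then 1 else 0) t) =
      (\<Sum>i\<in>{1..d}. \<rho> i / (1 - pole i) - \<rho> i * pole i ^ K / (1 - pole i))"
    proof (rule sum.cong)
      fix i assume "i \<in> {1..d}"
      then have "pole i \<noteq> 1" using stable by fastforce
      then show "\<rho> i * first_order (pole i) t0 (\<lambda>t. if t0 \<le> t then 1 else 0) t =
          \<rho> i / (1 - pole i) - \<rho> i * pole i ^ K / (1 - pole i)"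
        by (simp add: first_order_step[OF \<open>t0 \<le> t\<close>] K_def right_diff_distrib diff_divide_distrib)
    qed simp
    then show ?thesis
      using \<open>t0 \<le> t\<close> by (simp add: filter_pfd_def \<rho>_def)
  qed
  ultimately have "\<bar>filter_pfd d pole b t0 (\<lambda>t. if t0 \<le> t then 1 else 0) t\<bar> =
      \<bar>\<Sum>i\<in>{1..d}. \<rho> i * pole i ^ K / (1 - pole i)\<bar>"
    by (simp add: sum_subtractf)
  also have "\<dots> \<le> (\<Sum>i\<in>{1..d}. \<bar>\<rho> i\<bar> * (\<bar>p\<bar> ^ l / (1 - \<bar>p\<bar>)))"
  proof (rule order.trans[OF sum_abs], rule sum_mono)
    fix i assume i: "i \<in> {1..d}"
    have "\<bar>pole i\<bar> ^ K \<le> \<bar>p\<bar> ^ K"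
      using dom[OF i] by (simp add: power_mono)
    also have "\<dots> \<le> \<bar>p\<bar> ^ l"
      using p1 t by (intro power_decreasing) (auto simp: K_def)
    finally have "\<bar>pole i\<bar> ^ K / \<bar>1 - pole i\<bar> \<le> \<bar>p\<bar> ^ l / (1 - \<bar>p\<bar>)"
      using dom[OF i] p1 by (intro frac_le) auto
    then have "\<bar>\<rho> i\<bar> * (\<bar>pole i\<bar> ^ K / \<bar>1 - pole i\<bar>) \<le> \<bar>\<rho> i\<bar> * (\<bar>p\<bar> ^ l / (1 - \<bar>p\<bar>))"
      by (intro mult_left_mono) auto
    then show "\<bar>\<rho> i * pole i ^ K / (1 - pole i)\<bar> \<le> \<bar>\<rho> i\<bar> * (\<bar>p\<bar> ^ l / (1 - \<bar>p\<bar>))"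
      by (simp add: abs_mult power_abs)
  qed
  also have "\<dots> = (\<Sum>i\<in>{1..d}. \<bar>\<rho> i\<bar>) * (\<bar>p\<bar> ^ l / (1 - \<bar>p\<bar>))"
    by (simp only: sum_distrib_right)
  also have "\<dots> \<le> sqrt (real d * (\<Sum>i\<in>{1..d}. (\<rho> i)\<^sup>2)) * (\<bar>p\<bar> ^ l / (1 - \<bar>p\<bar>))"
  proof (rule mult_right_mono)
    \<comment> \<open>Cauchy-Schwarz against the all-ones vector of length \<open>d\<close>.\<close>
    show "(\<Sum>i\<in>{1..d}. \<bar>\<rho> i\<bar>) \<le> sqrt (real d * (\<Sum>i\<in>{1..d}. (\<rho> i)\<^sup>2))"
      using sum_squared_le_sum_of_squares[of "\<lambda>i. \<bar>\<rho> i\<bar>" "{1..d}"]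
      by (intro real_le_rsqrt) (simp add: mult.commute)
  qed (use p1 in auto)
  finally show ?thesis
    by (simp add: \<rho>_def)
qed

lemma L2_set_sum_le: "L2_set (\<lambda>x. \<Sum>i\<in>I. f i x) A \<le> (\<Sum>i\<in>I. L2_set (f i) A)"
proof (induction I rule: infinite_finite_induct)
  case (insert i I)
  then show ?case
    using L2_set_triangle_ineq[of "f i" "\<lambda>x. \<Sum>j\<in>I. f j x" A] by simp
qed (simp_all add: L2_set_0')

lemma L2_set_scale: "L2_set (\<lambda>x. c * f x) A = \<bar>c\<bar> * L2_set f A"
  by (simp add: L2_set_def power_mult_distrib real_sqrt_mult flip: sum_distrib_left)

text \<open>The window of length \<open>m\<close> reaches back at least to \<open>t0\<close>, so
  every sample of the delayed window outside it is zero.\<close>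

lemma L2_set_delayed_window_le:
  fixes s :: signal
  assumes "\<And>t. t < t0 \<Longrightarrow> s t = 0" and "k < t0 + int m"
  shows "L2_set (\<lambda>i. s (k - int i - int l)) {..<n} \<le> L2_set (\<lambda>i. s (k - int i)) {..<m}"
proof -
  have "(\<Sum>i<n. (s (k - int i - int l))\<^sup>2) = (\<Sum>i\<in>(+) l ` {..<n}. (s (k - int i))\<^sup>2)"
    by (subst sum.reindex) (auto simp: algebra_simps)
  also have "\<dots> \<le> (\<Sum>i\<in>(+) l ` {..<n} \<union> {..<m}. (s (k - int i))\<^sup>2)"
    by (rule sum_mono2) auto
  also have "\<dots> = (\<Sum>i<m. (s (k - int i))\<^sup>2)"
    by (rule sum.mono_neutral_right) (use assms in auto)
  finally show ?thesis
    by (simp add: L2_set_def)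
qed

text \<open>
  Young's inequality: the impulse response is geometric with ratio q, and its l1 norm is
  1 / (1 - |q|).
\<close>

lemma L2_set_first_order_le:
  assumes s: "\<And>t. t < t0 \<Longrightarrow> s t = 0" and m: "k < t0 + int m" and q: "\<bar>q\<bar> < 1"
  shows "L2_set (\<lambda>i. first_order q t0 s (k - int i)) {..<n} \<le>
    L2_set (\<lambda>i. s (k - int i)) {..<m} / (1 - \<bar>q\<bar>)"
proof -
  define S where "S = L2_set (\<lambda>i. s (k - int i)) {..<m}"
  \<comment> \<open>Zero samples pad the sum to a length independent of \<open>i\<close>, so that
    the triangle inequality applies to whole delayed windows.\<close>
  have "first_order q t0 s (k - int i) = (\<Sum>j<m. q ^ j * s (k - int i - int (Suc j)))" for i
    unfolding first_order_def by (rule sum.mono_neutral_cong_left) (use s m in \<open>auto simp: diff_diff_eq add.assoc\<close>)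
  then have "L2_set (\<lambda>i. first_order q t0 s (k - int i)) {..<n} \<le>
      (\<Sum>j<m. L2_set (\<lambda>i. q ^ j * s (k - int i - int (Suc j))) {..<n})"
    by (simp only: L2_set_sum_le)
  also have "\<dots> \<le> (\<Sum>j<m. \<bar>q\<bar> ^ j * S)"
    unfolding L2_set_scale power_abs S_def
    by (intro sum_mono mult_left_mono L2_set_delayed_window_le[OF s m]) auto
  also have "\<dots> = (1 - \<bar>q\<bar> ^ m) / (1 - \<bar>q\<bar>) * S"
    using q by (simp add: sum_gp_strict flip: sum_distrib_right)
  also have "\<dots> \<le> 1 / (1 - \<bar>q\<bar>) * S"
    using q by (intro mult_right_mono divide_right_mono) (auto simp: S_def)
  finally show ?thesis
    by (simp add: S_def)
qed

lemma L2_set_filter_pfd_le: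
  assumes s: "\<And>t. t < t0 \<Longrightarrow> s t = 0" and m: "k < t0 + int m"
    and stable: "\<forall>i\<in>{1..d}. \<bar>pole i\<bar> < 1"
  shows "L2_set (\<lambda>i. filter_pfd d pole b t0 s (k - int i)) {..<n} \<le>
    C_two d pole b * L2_set (\<lambda>i. s (k - int i)) {..<m}"
proof -
  define S where "S = L2_set (\<lambda>i. s (k - int i)) {..<m}"
  have "L2_set (\<lambda>i. filter_pfd d pole b t0 s (k - int i)) {..<n} \<le>
      \<bar>coeff b d\<bar> * L2_set (\<lambda>i. s (k - int i)) {..<n} +
      (\<Sum>l\<in>{1..d}. \<bar>pole_residue d pole b l\<bar> *
        L2_set (\<lambda>i. first_order (pole l) t0 s (k - int i)) {..<n})"
    unfolding filter_pfd_def L2_set_scale[symmetric]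
    by (intro order.trans[OF L2_set_triangle_ineq] add_left_mono L2_set_sum_le)
  also have "\<dots> \<le> \<bar>coeff b d\<bar> * S +
      (\<Sum>l\<in>{1..d}. \<bar>pole_residue d pole b l\<bar> * (S / (1 - \<bar>pole l\<bar>)))"
    unfolding S_def
    \<comment> \<open>The case of delay zero handles the feedthrough term.\<close>
    using L2_set_delayed_window_le[OF s m, where l = 0 and n = n] stable
    by (intro add_mono mult_left_mono sum_mono L2_set_first_order_le[OF s m]) auto
  also have "\<dots> = C_two d pole b * S"
    by (simp add: C_two_def distrib_right sum_distrib_right)
  finally show ?thesis
    by (simp add: S_def)
qed

section \<open>Regression\<close>

lemma gram_mult: "gram n A *v v = (\<Sum>i<n. (A i \<bullet> v) *\<^sub>R A i)"
proof (rule iffD2[OF vec_eq_iff], rule allI)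
  fix j
  show "(gram n A *v v) $ j = (\<Sum>i<n. (A i \<bullet> v) *\<^sub>R A i) $ j"
    by (simp add: gram_def matrix_vector_mult_def inner_vec_def sum_2 sum_distrib_left sum_distrib_right
        distrib_left sum.distrib mult_ac)
qed

lemma matrix_inv_mult:
  fixes M :: "real ^ 'n ^ 'n"
  assumes "det M \<noteq> 0"
  shows "M *v (matrix_inv M *v v) = v" and "matrix_inv M *v (M *v v) = v"
proof -
  have "\<exists>B. M ** B = mat 1 \<and> B ** M = mat 1"
    using assms unfolding invertible_det_nz[symmetric] invertible_def .
  \<comment> \<open>\<open>matrix_inv\<close> is defined by choice, so its two equations follow from
    the existence of an inverse.\<close>
  then have "M ** matrix_inv M = mat 1 \<and> matrix_inv M ** M = mat 1"
    unfolding matrix_inv_def by (rule someI_ex)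
  then show "M *v (matrix_inv M *v v) = v" and "matrix_inv M *v (M *v v) = v"
    by (simp_all add: matrix_vector_mul_assoc)
qed

text \<open>The pseudo-inverse is a left inverse, so the estimation error is its image of the data
  misfit.\<close>

lemma pinv_mult_diff:
  assumes "det (gram n A) \<noteq> 0"
  shows "pinv_mult n A y - v = pinv_mult n A (\<lambda>i. y i - A i \<bullet> v)"
proof -
  have "(\<Sum>i<n. (y i - A i \<bullet> v) *\<^sub>R A i) = (\<Sum>i<n. y i *\<^sub>R A i) - gram n A *v v"
    by (simp add: gram_mult scaleR_diff_left sum_subtractf)
  then show ?thesis
    using assms by (simp add: pinv_mult_def matrix_vector_mult_diff_distrib matrix_inv_mult)
qed

text \<open>The fitted values are a projection of \<open>y\<close>, so their squared norm
  \<open>Q\<close> is at most that of \<open>y\<close>; trace and determinant of the Gram matrix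
  compare \<open>Q\<close> with the squared norm of the solution.\<close>

lemma norm_pinv_mult_le:
  assumes det: "det (gram n A) > 0"
  shows "(norm (pinv_mult n A y))\<^sup>2 * det (gram n A) \<le> trace (gram n A) * (\<Sum>i<n. (y i)\<^sup>2)"
proof -
  define v where "v = pinv_mult n A y"
  define Q where "Q = (\<Sum>i<n. (A i \<bullet> v)\<^sup>2)"
  define M where "M = gram n A"
  have Q: "Q = v \<bullet> (M *v v)"
    by (simp add: M_def gram_mult Q_def inner_sum_right power2_eq_square inner_commute)
  also have "M *v v = (\<Sum>i<n. y i *\<^sub>R A i)"
    using det by (simp add: M_def v_def pinv_mult_def matrix_inv_mult)
  \<comment> \<open>The normal equations turn \<open>Q\<close> into the inner product of
    \<open>y\<close> with the fitted values; Cauchy-Schwarz and division by \<open>Q\<close> then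
    bound it.\<close>
  finally have "Q = (\<Sum>i<n. y i * (A i \<bullet> v))"
    by (simp add: inner_sum_right inner_commute)
  then have "Q\<^sup>2 \<le> (\<Sum>i<n. (y i)\<^sup>2) * Q"
    using Cauchy_Schwarz_ineq_sum[of y "\<lambda>i. A i \<bullet> v" "{..<n}"] by (simp add: Q_def)
  moreover have "Q \<ge> 0"
    by (simp add: Q_def sum_nonneg)
  ultimately have QY: "Q \<le> (\<Sum>i<n. (y i)\<^sup>2)"
    by (cases "Q = 0") (auto simp: power2_eq_square sum_nonneg)
  have M: "M $ 2 $ 1 = M $ 1 $ 2"
    by (simp add: M_def gram_def mult.commute)
  \<comment> \<open>Cayley-Hamilton: trace M * M - det M is the square of the symmetric matrix M.\<close>
  have "trace M * Q - det M * (norm v)\<^sup>2 = (norm (M *v v))\<^sup>2"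
    unfolding Q power2_norm_eq_inner
    by (simp add: inner_vec_def sum_2 matrix_vector_mult_def det_2 trace_def M) algebra
  then have "det M * (norm v)\<^sup>2 \<le> trace M * Q"
    by (smt (verit) zero_le_power2)
  also have "\<dots> \<le> trace M * (\<Sum>i<n. (y i)\<^sup>2)"
    by (intro mult_left_mono QY) (auto simp: M_def gram_def trace_def intro!: sum_nonneg)
  finally show ?thesis
    by (simp add: v_def M_def mult.commute)
qed

section \<open>Mean and deviation over a window\<close>

lemma avg_sq_le: "(avg m s k)\<^sup>2 \<le> (\<Sum>i<m. (s (k - int i))\<^sup>2) / real m"
  using sum_squared_le_sum_of_squares[of "\<lambda>i. s (k - int i)" "{..<m}"]
  by (cases "m = 0") (auto simp: avg_def power2_eq_square field_simps)

lemma stdev_nonneg: "stdev m s k \<ge> 0"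
  using avg_sq_le by (simp add: stdev_def)

text \<open>The squared mean never exceeds the mean square, so squaring \<open>stdev\<close> really
  undoes its square root.\<close>

lemma sum_squares_window:
  assumes "m \<ge> 1"
  shows "(\<Sum>i<m. (s (k - int i))\<^sup>2) = real m * ((stdev m s k)\<^sup>2 + (avg m s k)\<^sup>2)"
  using assms avg_sq_le[of m s k] by (simp add: stdev_def)

lemma sum_deviation_sq:
  assumes "m \<ge> 1"
  shows "(\<Sum>i<m. (s (k - int i) - avg m s k)\<^sup>2) = real m * (stdev m s k)\<^sup>2"
proof -
  define \<mu> where "\<mu> = avg m s k"
  have S1: "(\<Sum>i<m. s (k - int i)) = real m * \<mu>"
    using assms by (simp add: \<mu>_def avg_def)
  have "(\<Sum>i<m. (s (k - int i) - \<mu>)\<^sup>2) =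
      (\<Sum>i<m. (s (k - int i))\<^sup>2) - 2 * \<mu> * (\<Sum>i<m. s (k - int i)) + real m * \<mu>\<^sup>2"
    by (simp add: power2_diff sum.distrib sum_subtractf sum_distrib_left mult_ac)
  also have "\<dots> = real m * (stdev m s k)\<^sup>2"
    unfolding S1 sum_squares_window[OF assms] \<mu>_def
    by (simp add: algebra_simps power2_eq_square)
  finally show ?thesis
    by (simp only: \<mu>_def)
qed

text \<open>The Gram matrix has entries n, n \<mu>, n \<mu> and n (V^2 + \<mu>^2). Hence its trace
  over its determinant is C^2 / (n V^2), whose square root is the factor in the bound.\<close>

lemma norm_regression_diff_le:
  assumes "n \<ge> 1" and "stdev n e k \<noteq> 0"
  shows "norm (regression n e r k - v) \<le> C_reg n e k / (sqrt (real n) * stdev n e k) *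
    L2_set (\<lambda>i. r (k - int i) - regressor e k i \<bullet> v) {..<n}"
proof -
  define A where "A = regressor e k"
  define V where "V = stdev n e k"
  define \<mu> where "\<mu> = avg n e k"
  define C where "C = C_reg n e k"
  define y where "y = (\<lambda>i. r (k - int i) - A i \<bullet> v)"
  define W where "W = L2_set y {..<n}"
  have V: "V > 0"
    using stdev_nonneg[of n e k] assms by (simp add: V_def)
  have S1: "(\<Sum>i<n. e (k - int i)) = real n * \<mu>"
    using assms(1) by (simp add: \<mu>_def avg_def)
  have S2: "(\<Sum>i<n. e (k - int i) * e (k - int i)) = real n * (V\<^sup>2 + \<mu>\<^sup>2)"
    using sum_squares_window[of n e k] assms(1) by (simp add: V_def \<mu>_def power2_eq_square)
  have det: "det (gram n A) = (real n)\<^sup>2 * V\<^sup>2"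
    by (simp add: det_2 gram_def A_def regressor_def S1 S2 power2_eq_square algebra_simps)
  have tr: "trace (gram n A) = real n * C\<^sup>2"
    by (simp add: trace_def sum_2 gram_def A_def regressor_def S2 C_def C_reg_def V_def \<mu>_def
        algebra_simps)
  have pos: "det (gram n A) > 0"
    using V assms(1) by (simp add: det)
  have C: "C \<ge> 0" and W: "W \<ge> 0"
    by (simp_all add: C_def C_reg_def W_def)
  have "(norm (pinv_mult n A y))\<^sup>2 * ((real n)\<^sup>2 * V\<^sup>2) \<le> real n * C\<^sup>2 * W\<^sup>2"
    using norm_pinv_mult_le[OF pos, of y] by (simp add: det tr W_def L2_set_def sum_nonneg)
  then have "(norm (pinv_mult n A y) * (real n * V))\<^sup>2 \<le> (sqrt (real n) * C * W)\<^sup>2"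
    by (simp add: power_mult_distrib)
  then have "norm (pinv_mult n A y) * (real n * V) \<le> sqrt (real n) * C * W"
    by (rule power2_le_imp_le) (use C W in simp)
  then have "norm (pinv_mult n A y) \<le> sqrt (real n) * C * W / (real n * V)"
    using V assms(1) by (simp add: pos_le_divide_eq)
  also have "\<dots> = C / (sqrt (real n) * V) * W"
    using V assms(1) by (simp add: field_simps)
  finally have "norm (pinv_mult n A y) \<le> C / (sqrt (real n) * V) * W" .
  moreover have "regression n e r k - v = pinv_mult n A y"
    unfolding regression_def A_def[symmetric] y_def using pos by (intro pinv_mult_diff) simp
  ultimately show ?thesis
    by (simp add: C_def V_def W_def y_def A_def)
qed

section \<open>Estimation error of the complete filter\<close>

theorem corollary3p6:
  fixes H :: "(real poly) ^ 'x ^ 'r"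
    and L :: "(real poly) ^ 'z ^ 'r"
    and F N :: "(real poly) ^ 'r"
    and x :: "int \<Rightarrow> real ^ 'x"
    and z :: "int \<Rightarrow> real ^ 'z"
    and f_a f_m e r :: signal
    and E :: "real ^ 'z \<Rightarrow> real"
    and pole :: "nat \<Rightarrow> real"
    and a b :: "real poly"
    and d dN n :: nat
    and p fbar_a fbar_m :: real
    and k0 k :: int
  assumes detectable: "poly_rank (append_col H F) > poly_rank H"
    and system: "\<forall>t. mat_op H x t + mat_op L z t + col_op F (\<lambda>s. f_a s + E (z s) * f_m s) t = 0"
    and a: "a = denominator d pole"
    and poles_distinct: "inj_on pole {1..d}"
    and poles_stable: "\<forall>i\<in>{1..d}. \<bar>pole i\<bar> < 1"
    and dominant: "dominant_pole d pole p"
    and lp: "detection_lp dN H F a N"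
    and proper: "proper_filter L F a N"
    and b: "b = numerator N F a"
    and r: "r = residual L a N z"
    and prefilter: "e = (\<lambda>t. E (z t))"
    and fault_a: "constant_from (k0 + 1) f_a fbar_a"
    and fault_m: "constant_from (k0 + 1) f_m fbar_m"
    and n: "n \<ge> 1"
    and k: "k \<ge> k0 + int n"
    and excitation: "stdev n e k \<noteq> 0"
  shows "norm (regression n e r k - vector [f_a k, f_m k]) \<le>
      C_reg n e k / (sqrt (real n) * stdev n e k) *
      (C_one n d pole b p * (\<bar>fbar_a\<bar> + \<bar>fbar_m\<bar> * \<bar>avg (nat (k - k0)) e k\<bar>)
          * \<bar>p\<bar> ^ nat (k - int n - k0)
        + C_two d pole b * sqrt (real_of_int (k - k0)) * \<bar>fbar_m\<bar> * stdev (nat (k - k0)) e k)"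
proof -
  define t0 where "t0 = k0 + 1"
  \<comment> \<open>The window of \<open>m\<close> samples ending at \<open>k\<close> begins exactly
    at \<open>t0\<close>, the first faulty sample.\<close>
  define m where "m = nat (k - k0)"
  define g where "g = (\<lambda>t. f_a t + e t * f_m t)"
  define \<mu> where "\<mu> = avg m e k"
  define u where "u = (\<lambda>t. if t0 \<le> t then 1 else (0 :: real))"
  define v where "v = (\<lambda>t. if t0 \<le> t then e t - \<mu> else 0)"
  define w where "w = filter_pfd d pole b t0"
  define c where "c = fbar_a + fbar_m * \<mu>"
  define \<theta> where "\<theta> = (vector [f_a k, f_m k] :: real ^ 2)"
  have m: "int m = k - k0" "m \<ge> 1" "m \<ge> n"
    using k n by (auto simp: m_def)
  have fault: "f_a t = (if t0 \<le> t then fbar_a else 0)" "f_m t = (if t0 \<le> t then fbar_m else 0)" for t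
    using fault_a fault_m by (auto simp: constant_from_def t0_def)
  have window: "t0 \<le> k - int i" if "i < n" for i
    using that k by (simp add: t0_def)
  \<comment> \<open>The dominant pole is one of the poles, so there is at least one.\<close>
  have d: "d \<ge> 1"
    using dominant by (auto simp: dominant_pole_def)
  have deg_b: "degree b \<le> d"
    unfolding b numerator_def using proper
    by (intro degree_diff_le) (auto simp: proper_filter_def a degree_denominator)
  \<comment> \<open>The normalisation in the linear program says that the fault-to-residual gain at
    1 is one, so its deviation b/a from the identity has no steady-state gain.\<close>
  have b1: "poly b 1 = 0"
    using lp by (simp add: b numerator_def detection_lp_def)
  have g_past: "g t = 0" if "t < t0" for t
    using that by (simp add: g_def fault)
  have input: "row_op N (mat_op L z) = shift_op (- row_times_col N F) g"
  proof
    fix t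
    have "\<forall>t. mat_op H x t + mat_op L z t + col_op F g t = 0"
      using system by (simp add: g_def prefilter)
    then show "row_op N (mat_op L z) t = shift_op (- row_times_col N F) g t"
      by (rule row_op_residual_input) (use lp in \<open>simp add: detection_lp_def\<close>)
  qed
  have "- row_times_col N F = denominator d pole + b"
    by (simp add: b numerator_def a)
  then have residual: "r t = g t + w g t" if "t0 \<le> t" for t
    using inv_shift_op_eq_filter_pfd[where s = g, OF poles_distinct deg_b d g_past that]
    by (simp add: r residual_def input a w_def)
  \<comment> \<open>The whole regression window lies after the onset, where the regressor applied to
    the constant faults equals \<open>g\<close>.\<close>
  have "r (k - int i) - regressor e k i \<bullet> \<theta> = w g (k - int i)" if "i < n" for i
    using residual[OF window[OF that]] window[OF that] window[of 0] n
    by (simp add: g_def fault regressor_def \<theta>_def inner_vec_def sum_2)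
  then have err: "L2_set (\<lambda>i. r (k - int i) - regressor e k i \<bullet> \<theta>) {..<n} =
      L2_set (\<lambda>i. w g (k - int i)) {..<n}"
    by (intro L2_set_cong) auto
  \<comment> \<open>Centring \<open>e\<close> at its mean since the onset splits \<open>g\<close>
    into a step of height \<open>c\<close> and a deviation whose norm is governed by
    \<open>stdev\<close>.\<close>
  have "g = (\<lambda>t. c * u t + fbar_m * v t)"
    by (auto simp: g_def fault u_def v_def c_def algebra_simps)
  then have "w g t = c * w u t + fbar_m * w v t" for t
    by (simp only: w_def filter_pfd_add filter_pfd_scale)
  then have "L2_set (\<lambda>i. w g (k - int i)) {..<n} \<le>
      \<bar>c\<bar> * L2_set (\<lambda>i. w u (k - int i)) {..<n} + \<bar>fbar_m\<bar> * L2_set (\<lambda>i. w v (k - int i)) {..<n}"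
    unfolding L2_set_scale[symmetric] by (simp only: L2_set_triangle_ineq)
  also have "\<dots> \<le> \<bar>c\<bar> * (C_one n d pole b p * \<bar>p\<bar> ^ (m - n)) +
      \<bar>fbar_m\<bar> * (C_two d pole b * (sqrt (real m) * stdev m e k))"
  proof (intro add_mono mult_left_mono)
    define B where "B = sqrt (real d * (\<Sum>i\<in>{1..d}. (pole_residue d pole b i)\<^sup>2)) / (1 - \<bar>p\<bar>) *
      \<bar>p\<bar> ^ (m - n)"
    \<comment> \<open>The oldest regression sample, at \<open>k - n + 1\<close>, is exactly
      \<open>m - n\<close> steps after \<open>t0\<close>; this fixes the exponent.\<close>
    have wu: "\<bar>w u (k - int i)\<bar> \<le> B" if "i < n" for i
      unfolding w_def u_def B_def
      by (rule filter_pfd_step_bound)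
        (use poles_distinct deg_b d poles_stable dominant b1 that m in \<open>auto simp: t0_def\<close>)
    have "L2_set (\<lambda>i. w u (k - int i)) {..<n} = L2_set (\<lambda>i. \<bar>w u (k - int i)\<bar>) {..<n}"
      by (simp add: L2_set_def)
    also have "\<dots> \<le> L2_set (\<lambda>i. B) {..<n}"
      using wu by (intro L2_set_mono) auto
    also have "\<dots> = sqrt (real n) * B"
      using order.trans[OF abs_ge_zero wu[of 0]] n by (simp add: L2_set_constant)
    \<comment> \<open>The factor \<open>sqrt n\<close> from the length of the window is the one
      inside \<open>C_one\<close>.\<close>
    also have "\<dots> = C_one n d pole b p * \<bar>p\<bar> ^ (m - n)"
      by (simp add: B_def C_one_def real_sqrt_mult)
    finally show "L2_set (\<lambda>i. w u (k - int i)) {..<n} \<le> C_one n d pole b p * \<bar>p\<bar> ^ (m - n)" .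
    have "L2_set (\<lambda>i. w v (k - int i)) {..<n} \<le> C_two d pole b * L2_set (\<lambda>i. v (k - int i)) {..<m}"
      unfolding w_def
      by (rule L2_set_filter_pfd_le) (use poles_stable m in \<open>auto simp: v_def t0_def\<close>)
    also have "L2_set (\<lambda>i. v (k - int i)) {..<m} = L2_set (\<lambda>i. e (k - int i) - \<mu>) {..<m}"
      using m by (intro L2_set_cong) (auto simp: v_def t0_def)
    also have "\<dots> = sqrt (real m) * stdev m e k"
      using sum_deviation_sq[OF m(2), of e k] stdev_nonneg[of m e k]
      by (simp add: L2_set_def \<mu>_def real_sqrt_mult)
    finally show "L2_set (\<lambda>i. w v (k - int i)) {..<n} \<le>
      C_two d pole b * (sqrt (real m) * stdev m e k)" .
  qed auto
  also have "\<dots> \<le> (\<bar>fbar_a\<bar> + \<bar>fbar_m\<bar> * \<bar>\<mu>\<bar>) * (C_one n d pole b p * \<bar>p\<bar> ^ (m - n)) +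
      \<bar>fbar_m\<bar> * (C_two d pole b * (sqrt (real m) * stdev m e k))"
  proof (intro add_right_mono mult_right_mono)
    show "\<bar>c\<bar> \<le> \<bar>fbar_a\<bar> + \<bar>fbar_m\<bar> * \<bar>\<mu>\<bar>"
      unfolding c_def by (metis abs_mult abs_triangle_ineq)
    have "\<bar>p\<bar> < 1"
      using dominant poles_stable by (auto simp: dominant_pole_def)
    then show "0 \<le> C_one n d pole b p * \<bar>p\<bar> ^ (m - n)"
      by (auto simp: C_one_def intro!: mult_nonneg_nonneg divide_nonneg_nonneg sum_nonneg)
  qed
  also have "\<dots> = C_one n d pole b p * (\<bar>fbar_a\<bar> + \<bar>fbar_m\<bar> * \<bar>\<mu>\<bar>) * \<bar>p\<bar> ^ (m - n) +
      C_two d pole b * sqrt (real m) * \<bar>fbar_m\<bar> * stdev m e k"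
    by simp
  finally have bound: "L2_set (\<lambda>i. w g (k - int i)) {..<n} \<le> \<dots>" .
  have "norm (regression n e r k - \<theta>) \<le>
      C_reg n e k / (sqrt (real n) * stdev n e k) * L2_set (\<lambda>i. w g (k - int i)) {..<n}"
    using norm_regression_diff_le[OF n excitation, of r \<theta>] err by simp
  also have "\<dots> \<le> C_reg n e k / (sqrt (real n) * stdev n e k) *
      (C_one n d pole b p * (\<bar>fbar_a\<bar> + \<bar>fbar_m\<bar> * \<bar>\<mu>\<bar>) * \<bar>p\<bar> ^ (m - n) +
        C_two d pole b * sqrt (real m) * \<bar>fbar_m\<bar> * stdev m e k)"
    using bound stdev_nonneg[of n e k] by (intro mult_left_mono) (auto simp: C_reg_def)
  finally have main: "norm (regression n e r k - \<theta>) \<le> \<dots>" .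
  \<comment> \<open>Since \<open>n \<le> m\<close>, the subtraction of naturals is not
    truncated.\<close>
  have "m - n = nat (k - int n - k0)" "real m = real_of_int (k - k0)"
    using m by linarith+
  with main show ?thesis
    by (simp only: \<theta>_def \<mu>_def m_def)
qed

end
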